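(* For every $k\in\mathbb{N}$, $M(k)=P(k)+k$. In particular, $P(k)=O(k^2)$ as $k\to\infty$ if and only if $M(k)=O(k^2)$ as $k\to\infty$.
   Context: Graphs are finite, simple and undirected. For a graph $G$ with adjacency matrix $A(G)$, $n^+(G)$, $n^0(G)$, $n^-(G)$ denote the number of positive, zero and negative eigenvalues of $A(G)$, respectively, counted with multiplicity. For $k\in\mathbb{N}=\{1,2,\dots\}$ define \[ P(k):=\max_G\{n^+(G): n^-(G)\le k\},\qquad M(k):=\max_G\{|V(G)|: n^0(G)+n^-(G)\le k\},\] where the maxima range over all graphs $G$. (It is known that $n^+(G)$ is bounded above by a function, exponential, of $n^-(G)$, so these maxima are finite.) *)

theory Defs
  imports
    "Graph_Theory.Pair_Digraph"
    "Jordan_Normal_Form.Char_Poly"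
    "HOL-Library.Landau_Symbols"
begin

(* A finite simple undirected graph is a pair_graph: a finite vertex set with a
   symmetric, loop-free arc relation, each edge uv being the two arcs (u,v) and (v,u).

   The rows and columns are indexed by the vertices in increasing order. *)
definition adj_mat :: "'a::linorder pair_pre_digraph \<Rightarrow> real mat" where
  "adj_mat G =
     (let vs = sorted_list_of_set (pverts G); n = card (pverts G)
      in mat n n (\<lambda>(i, j). if (vs ! i, vs ! j) \<in> parcs G then 1 else 0))"

(* Multiplicity is algebraic multiplicity. All eigenvalues of a symmetric real matrix
   are real, so real eigenvalues suffice. *)
definition eig_count :: "(real \<Rightarrow> bool) \<Rightarrow> 'a::linorder pair_pre_digraph \<Rightarrow> nat" where
  "eig_count Q G =
     (\<Sum>x | eigenvalue (adj_mat G) x \<and> Q x. order x (char_poly (adj_mat G)))"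

definition n_pos :: "'a::linorder pair_pre_digraph \<Rightarrow> nat" where
  "n_pos G = eig_count (\<lambda>x. x > 0) G"

definition n_zero :: "'a::linorder pair_pre_digraph \<Rightarrow> nat" where
  "n_zero G = eig_count (\<lambda>x. x = 0) G"

definition n_neg :: "'a::linorder pair_pre_digraph \<Rightarrow> nat" where
  "n_neg G = eig_count (\<lambda>x. x < 0) G"

(* Vertices are drawn from nat, which covers every finite graph up to isomorphism.
   Max is meaningful only on finite nonempty sets; n_pos is bounded in terms of n_neg,
   so both sets below are finite. *)
definition P_max :: "nat \<Rightarrow> nat" where
  "P_max k = Max {n_pos G | G :: nat pair_pre_digraph. pair_graph G \<and> n_neg G \<le> k}"

definition M_max :: "nat \<Rightarrow> nat" where
  "M_max k =
     Max {card (pverts G) | G :: nat pair_pre_digraph. pair_graph G \<and> n_zero G + n_neg G \<le> k}"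

end

theory Submission
  imports
    Defs
    "Jordan_Normal_Form.Spectral_Radius"
    "Jordan_Normal_Form.Schur_Decomposition"
    "HOL-Library.Ramsey"
begin

text \<open>
  Inertia is invariant under restricting the quadratic form of the adjacency matrix to a complement
  of a null vector. Hence deleting a vertex on which some null vector is nonzero keeps
  the positive and negative counts and lowers the zero count by one, and adding an isolated vertex
  is the reverse step. Starting from an extremal graph for \<open>P(k)\<close>, delete down to a nonsingular
  graph and then add isolated vertices until the zero and negative counts sum to \<open>k\<close>;
  the result has \<open>P(k) + k\<close> vertices. The other inequality holds because the three counts sum
  to the number of vertices.

  \<open>P(k)\<close> is finite by Ramsey's theorem applied to nonsingular graphs: the form vanishes on the span of
  an independent set and is negative definite on the vectors of sum zero supported on a clique,
  so both kinds of sets have size at most \<open>k + 1\<close>.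
\<close>

section \<open>The spectral theorem for real symmetric matrices\<close>

lemma conjugate_real_vec [simp]: "conjugate (v :: real vec) = v"
  by (rule eq_vecI) auto

text \<open>A complex eigenvalue \<open>k\<close> exists in positive dimension. Moving the symmetric
  real matrix across the Hermitian product of an eigenvector with itself gives
  \<open>k = cnj k\<close>, so \<open>k\<close> is a real root of the characteristic
  polynomial.\<close>

lemma real_symmetric_eigenvalue_exists:
  fixes A :: "real mat"
  assumes A: "A \<in> carrier_mat n n" and sym: "transpose_mat A = A" and n: "n > 0"
  shows "\<exists>e. eigenvalue A e"
proof -
  let ?B = "map_mat complex_of_real A"
  have B: "?B \<in> carrier_mat n n" using A by simp
  obtain k where k: "eigenvalue ?B k"
    using spectrum_non_empty[OF B n] by (auto simp: spectrum_def)
  then obtain v where v: "v \<in> carrier_vec n" "v \<noteq> 0\<^sub>v n" "?B *\<^sub>v v = k \<cdot>\<^sub>v v"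
    using B unfolding eigenvalue_def eigenvector_def by auto
  have symB: "?B $$ (i, j) = ?B $$ (j, i)" if "i < n" "j < n" for i j
    using arg_cong[OF sym, of "\<lambda>M. M $$ (i, j)"] A that by simp
  have "k * (v \<bullet>c v) = (?B *\<^sub>v v) \<bullet>c v"
    using v by simp
  also have "\<dots> = (\<Sum>i<n. \<Sum>j<n. ?B $$ (i, j) * v $ j * cnj (v $ i))"
    using v(1) A by (auto simp: scalar_prod_def sum_distrib_right atLeast0LessThan
        intro!: sum.cong)
  also have "\<dots> = (\<Sum>j<n. \<Sum>i<n. ?B $$ (j, i) * v $ j * cnj (v $ i))"
    by (subst sum.swap) (intro sum.cong refl, use symB in auto)
  also have "\<dots> = v \<bullet>c (?B *\<^sub>v v)"
    using v(1) A by (auto simp: scalar_prod_def sum_distrib_left atLeast0LessThan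
        intro!: sum.cong)
  also have "\<dots> = cnj k * (v \<bullet>c v)"
    using v by (simp add: conjugate_smult_vec)
  finally have "k = cnj k"
    using v by simp
  then have "k = complex_of_real (Re k)"
    by (simp add: complex_eq_iff)
  then have "poly (char_poly ?B) (complex_of_real (Re k)) = 0"
    using k eigenvalue_root_char_poly[OF B] by simp
  moreover have "char_poly ?B = map_poly complex_of_real (char_poly A)"
    by (rule of_real_hom.char_poly_hom[OF A])
  ultimately have "poly (char_poly A) (Re k) = 0"
    by simp
  then show ?thesis
    using eigenvalue_root_char_poly[OF A] by blast
qed

text \<open>Deflation tool for the spectral theorem: complete \<open>v\<close> to a basis, apply
  Gram-Schmidt, which keeps the first vector, and normalise. The factor \<open>c\<close> is the
  reciprocal of the norm of \<open>v\<close>.\<close>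

lemma orthonormal_matrix_with_first_column:
  fixes v :: "real vec"
  assumes v: "v \<in> carrier_vec n" "v \<noteq> 0\<^sub>v n"
  obtains W c where "W \<in> carrier_mat n n" "transpose_mat W * W = 1\<^sub>m n" "col W 0 = c \<cdot>\<^sub>v v"
proof -
  interpret cof_vec_space n "TYPE(real)" .
  define ws where "ws = gram_schmidt n (basis_completion v)"
  note b = basis_completion[OF v]
  have n: "n > 0" using v by (cases n) auto
  have ws: "set ws \<subseteq> carrier_vec n" "corthogonal ws" "length ws = n"
    using gram_schmidt_result[OF b(2,4,5) ws_def] b(6) by auto
  have hd: "ws ! 0 = v"
    using gram_schmidt_hd[OF v(1)] b(6,7) n ws(3) unfolding ws_def
    by (metis hd_conv_nth length_0_conv less_irrefl list.collapse)
  define us where "us = map (\<lambda>w. (1 / sqrt (w \<bullet> w)) \<cdot>\<^sub>v w) ws"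
  define W where "W = mat_of_cols n us"
  have W: "W \<in> carrier_mat n n"
    using ws unfolding W_def us_def by (metis length_map mat_of_cols_carrier(1))
  have wi: "ws ! i \<in> carrier_vec n" if "i < n" for i
    using ws that by auto
  have col: "col W i = (1 / sqrt (ws ! i \<bullet> ws ! i)) \<cdot>\<^sub>v ws ! i" if "i < n" for i
    unfolding W_def us_def using ws wi that by (subst col_mat_of_cols) auto
  have "transpose_mat W * W = 1\<^sub>m n"
  proof (rule eq_matI)
    fix i j assume "i < dim_row (1\<^sub>m n)" "j < dim_col (1\<^sub>m n :: real mat)"
    then have ij: "i < n" "j < n" by auto
    have orth: "ws ! i \<bullet> ws ! j = 0 \<longleftrightarrow> i \<noteq> j"
      using corthogonalD[OF ws(2), of i j] ws(3) ij by simp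
    have pos: "ws ! i \<bullet> ws ! i > 0"
      using corthogonalD[OF ws(2), of i i] ws(3) ij
        conjugate_square_ge_0_vec[of "ws ! i"] by (simp add: less_le)
    have "(transpose_mat W * W) $$ (i, j) = col W i \<bullet> col W j"
      using W ij by simp
    also have "\<dots> = (1 / sqrt (ws ! i \<bullet> ws ! i)) * (1 / sqrt (ws ! j \<bullet> ws ! j)) * (ws ! i \<bullet> ws ! j)"
      using wi[OF ij(1)] wi[OF ij(2)] by (simp add: col ij)
    also have "\<dots> = (1\<^sub>m n) $$ (i, j)"
      using orth pos ij by (auto simp: field_simps)
    finally show "(transpose_mat W * W) $$ (i, j) = (1\<^sub>m n) $$ (i, j)" .
  qed (use W in auto)
  then show thesis
    using W col[OF n] hd that by simp
qed

text \<open>Induction on the dimension. Conjugating by an orthogonal matrix whose first column is an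
  eigenvector clears the first column below the corner, symmetry clears the first row, and the
  remaining block is again symmetric.\<close>

lemma real_symmetric_spectral:
  fixes A :: "real mat"
  assumes "A \<in> carrier_mat n n" and "transpose_mat A = A"
  shows "\<exists>P d. P \<in> carrier_mat n n \<and> transpose_mat P * P = 1\<^sub>m n \<and>
    transpose_mat P * A * P = mat n n (\<lambda>(i, j). if i = j then d i else 0)"
  using assms
proof (induction n arbitrary: A)
  case 0
  show ?case
    by (rule exI[of _ "1\<^sub>m 0"], rule exI[of _ "\<lambda>_. 0"]) (use 0 in auto)
next
  case (Suc n A)
  note A = Suc.prems
  obtain e v where v: "v \<in> carrier_vec (Suc n)" "v \<noteq> 0\<^sub>v (Suc n)" "A *\<^sub>v v = e \<cdot>\<^sub>v v"
    using real_symmetric_eigenvalue_exists[OF A] A unfolding eigenvalue_def eigenvector_def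
    by auto
  obtain W c where W: "W \<in> carrier_mat (Suc n) (Suc n)" "transpose_mat W * W = 1\<^sub>m (Suc n)"
    "col W 0 = c \<cdot>\<^sub>v v"
    using orthonormal_matrix_with_first_column[OF v(1,2)] by blast
  define B where "B = transpose_mat W * A * W"
  have B: "B \<in> carrier_mat (Suc n) (Suc n)" using A W by (simp add: B_def)
  have Bsym: "transpose_mat B = B"
    using A W by (simp add: B_def transpose_mult[of _ "Suc n" "Suc n" _ "Suc n"]
        assoc_mult_mat[of _ "Suc n" "Suc n" _ "Suc n" _ "Suc n"])
  have B0: "B $$ (i, 0) = (if i = 0 then e else 0)" if "i < Suc n" for i
  proof -
    have "B $$ (i, 0) = (transpose_mat W * (A * W)) $$ (i, 0)"
      using A W by (simp add: B_def assoc_mult_mat[of _ "Suc n" "Suc n" _ "Suc n" _ "Suc n"])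
    also have "\<dots> = col W i \<bullet> (A *\<^sub>v col W 0)"
      using A W(1) that col_mult2[OF A(1) W(1), of 0]
      by (subst index_mult_mat(1)) (simp_all del: col_mult2)
    also have "A *\<^sub>v col W 0 = e \<cdot>\<^sub>v col W 0"
      using A v by (simp add: W(3) mult_mat_vec[of _ "Suc n" "Suc n"] smult_smult_assoc mult.commute)
    also have "col W i \<bullet> (e \<cdot>\<^sub>v col W 0) = e * (transpose_mat W * W) $$ (i, 0)"
      using W(1) that by simp
    also have "\<dots> = (if i = 0 then e else 0)"
      unfolding W(2) using that by simp
    finally show ?thesis .
  qed
  define C where "C = mat n n (\<lambda>(i, j). B $$ (Suc i, Suc j))"
  have C: "C \<in> carrier_mat n n" by (simp add: C_def)
  have Bs: "B $$ (i, j) = B $$ (j, i)" if "i < Suc n" "j < Suc n" for i j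
    using arg_cong[OF Bsym, of "\<lambda>M. M $$ (i, j)"] B that by simp
  have Csym: "transpose_mat C = C"
    by (rule eq_matI) (auto simp: C_def Bs)
  obtain P d where P: "P \<in> carrier_mat n n" "transpose_mat P * P = 1\<^sub>m n"
    "transpose_mat P * C * P = mat n n (\<lambda>(i, j). if i = j then d i else 0)"
    using Suc.IH[OF C Csym] by blast
  let ?E = "mat 1 1 (\<lambda>_. e)"
  let ?Z = "0\<^sub>m 1 n :: real mat" and ?Z' = "0\<^sub>m n 1 :: real mat"
  have Bblock: "B = four_block_mat ?E ?Z ?Z' C"
  proof (rule eq_matI)
    fix i j assume "i < dim_row (four_block_mat ?E ?Z ?Z' C)" "j < dim_col (four_block_mat ?E ?Z ?Z' C)"
    then have ij: "i < Suc n" "j < Suc n" by (auto simp: C_def)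
    show "B $$ (i, j) = four_block_mat ?E ?Z ?Z' C $$ (i, j)"
      using ij B0[of i] B0[of j] Bs[of 0 j] by (cases i; cases j) (auto simp: C_def)
  qed (use B in \<open>auto simp: C_def\<close>)
  \<comment> \<open>\<open>Q\<close> leaves the first coordinate alone and diagonalises the block
    \<open>C\<close>, so \<open>W * Q\<close> is the orthogonal matrix sought.\<close>
  define Q where "Q = four_block_mat (1\<^sub>m 1) ?Z ?Z' P"
  have Q: "Q \<in> carrier_mat (Suc n) (Suc n)" using P by (auto simp: Q_def)
  have Qt: "transpose_mat Q = four_block_mat (1\<^sub>m 1) ?Z ?Z' (transpose_mat P)"
    unfolding Q_def by (subst transpose_four_block_mat[of _ 1 1 _ n _ n]) (use P in auto)
  have QQ: "transpose_mat Q * Q = 1\<^sub>m (Suc n)"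
    unfolding Qt unfolding Q_def
    by (subst mult_four_block_mat[of _ 1 1 _ n _ n _ _ 1 _ n]) (use P in auto)
  have QBQ: "transpose_mat Q * B * Q =
      four_block_mat ?E ?Z ?Z' (transpose_mat P * C * P)"
    unfolding Qt Bblock unfolding Q_def
    apply (subst mult_four_block_mat[of _ 1 1 _ n _ n _ _ 1 _ n]; (use P C in simp)?)
    apply (subst mult_four_block_mat[of _ 1 1 _ n _ n _ _ 1 _ n]; (use P C in simp)?)
    done
  define d' where "d' i = (case i of 0 \<Rightarrow> e | Suc j \<Rightarrow> d j)" for i
  have diag: "four_block_mat ?E ?Z ?Z' (transpose_mat P * C * P) =
      mat (Suc n) (Suc n) (\<lambda>(i, j). if i = j then d' i else 0)"
    unfolding P(3) by (rule eq_matI) (auto simp: d'_def split: nat.splits)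
  have "transpose_mat (W * Q) * (W * Q) = transpose_mat Q * (transpose_mat W * W) * Q"
    using W(1) Q by (simp add: transpose_mult[of _ "Suc n" "Suc n" _ "Suc n"]
        assoc_mult_mat[of _ "Suc n" "Suc n" _ "Suc n" _ "Suc n"])
  moreover have "transpose_mat (W * Q) * A * (W * Q) = transpose_mat Q * B * Q"
    using W(1) Q A by (simp add: B_def transpose_mult[of _ "Suc n" "Suc n" _ "Suc n"]
        assoc_mult_mat[of _ "Suc n" "Suc n" _ "Suc n" _ "Suc n"])
  ultimately show ?case
    using W Q QQ QBQ diag
    by (intro exI[of _ "W * Q"] exI[of _ d']) (simp add: W(2))
qed

text \<open>Turns algebraic multiplicities into a count of diagonal entries: the transpose of
  \<open>P\<close> is its inverse, so the characteristic polynomial is the product of the factors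
  \<open>[:- d i, 1:]\<close>, and the order at \<open>x\<close> is the number of \<open>i\<close>
  with \<open>d i = x\<close>.\<close>

lemma sum_order_char_poly_diagonalized:
  fixes A :: "real mat"
  assumes A: "A \<in> carrier_mat n n" and P: "P \<in> carrier_mat n n" "transpose_mat P * P = 1\<^sub>m n"
    and D: "transpose_mat P * A * P = mat n n (\<lambda>(i, j). if i = j then d i else 0)"
  shows "(\<Sum>x | eigenvalue A x \<and> Q x. order x (char_poly A)) = card {i. i < n \<and> Q (d i)}"
proof -
  let ?D = "mat n n (\<lambda>(i, j). if i = j then d i else 0)"
  have "P * transpose_mat P = 1\<^sub>m n"
    using mat_mult_left_right_inverse[of "transpose_mat P" n P] P by simp
  then have "similar_mat_wit ?D A (transpose_mat P) P"
    using A P D by (intro similar_mat_witI[of _ _ n]) auto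
  then have "char_poly A = char_poly ?D"
    using char_poly_similar[of ?D A] unfolding similar_mat_def by metis
  also have "\<dots> = (\<Prod>a\<leftarrow>diag_mat ?D. [:- a, 1:])"
    by (rule char_poly_upper_triangular[of _ n]) auto
  also have "diag_mat ?D = map d [0..<n]"
    by (auto simp: diag_mat_def)
  finally have cp: "char_poly A = (\<Prod>i<n. [:- d i, 1:])"
    by (simp add: prod.list_conv_set_nth atLeast0LessThan)
  have ord: "order x (char_poly A) = card {i. i < n \<and> d i = x}" for x
  proof -
    have "order x (char_poly A) = (\<Sum>i<n. order x [:- d i, 1:])"
      unfolding cp
      by (induction n) (auto simp: order_mult simp del: mult_pCons_left mult_pCons_right)
    also have "\<dots> = (\<Sum>i<n. if d i = x then 1 else 0)"
      by (intro sum.cong refl) (use order_linear in \<open>auto intro!: order_0I\<close>)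
    also have "\<dots> = card {i. i < n \<and> d i = x}"
      by (simp add: sum.If_cases Int_def)
    finally show ?thesis .
  qed
  have ev: "eigenvalue A x \<longleftrightarrow> x \<in> d ` {..<n}" for x
    unfolding eigenvalue_root_char_poly[OF A] cp by (auto simp: poly_prod)
  have "(\<Sum>x | eigenvalue A x \<and> Q x. order x (char_poly A)) =
      (\<Sum>x \<in> {x \<in> d ` {..<n}. Q x}. card {i. i < n \<and> d i = x})"
    by (simp add: ev ord)
  also have "\<dots> = card (\<Union>x \<in> {x \<in> d ` {..<n}. Q x}. {i. i < n \<and> d i = x})"
    by (rule card_UN_disjoint[symmetric]) auto
  also have "(\<Union>x \<in> {x \<in> d ` {..<n}. Q x}. {i. i < n \<and> d i = x}) = {i. i < n \<and> Q (d i)}"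
    by auto
  finally show ?thesis .
qed

section \<open>The quadratic form of a graph\<close>

text \<open>This is the quadratic form of the adjacency matrix; each edge contributes twice, once
  per arc. Indexing by vertices instead of positions makes forms of different graphs directly
  comparable.\<close>

definition qf :: "'a pair_pre_digraph \<Rightarrow> ('a \<Rightarrow> real) \<Rightarrow> real" where
  "qf G f = (\<Sum>(u, v) \<in> parcs G. f u * f v)"

text \<open>The vectors \<open>p i\<close> are orthonormal eigenvectors for the eigenvalues \<open>d i\<close>; only indices below
  the number of vertices matter.\<close>
definition spectral_basis ::
    "'a::linorder pair_pre_digraph \<Rightarrow> (nat \<Rightarrow> 'a \<Rightarrow> real) \<Rightarrow> (nat \<Rightarrow> real) \<Rightarrow> bool" where
  "spectral_basis G p d \<longleftrightarrow>
     (\<forall>i<card (pverts G). \<forall>j<card (pverts G).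
        (\<Sum>v\<in>pverts G. p i v * p j v) = (if i = j then 1 else 0)) \<and>
     (\<forall>f. \<forall>v\<in>pverts G. f v = (\<Sum>i<card (pverts G). (\<Sum>u\<in>pverts G. p i u * f u) * p i v)) \<and>
     (\<forall>f. qf G f = (\<Sum>i<card (pverts G). d i * (\<Sum>v\<in>pverts G. p i v * f v)\<^sup>2)) \<and>
     (\<forall>Q. eig_count Q G = card {i. i < card (pverts G) \<and> Q (d i)})"

lemma spectral_basisD:
  assumes "spectral_basis G p d"
  shows "i < card (pverts G) \<Longrightarrow> j < card (pverts G) \<Longrightarrow>
      (\<Sum>v\<in>pverts G. p i v * p j v) = (if i = j then 1 else 0)"
    and "v \<in> pverts G \<Longrightarrow> f v = (\<Sum>i<card (pverts G). (\<Sum>u\<in>pverts G. p i u * f u) * p i v)"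
    and "qf G f = (\<Sum>i<card (pverts G). d i * (\<Sum>v\<in>pverts G. p i v * f v)\<^sup>2)"
    and "eig_count Q G = card {i. i < card (pverts G) \<and> Q (d i)}"
  using assms unfolding spectral_basis_def by blast+

lemma pair_graph_simple:
  assumes "pair_graph G"
  shows "finite (pverts G)" "finite (parcs G)" "parcs G \<subseteq> pverts G \<times> pverts G"
    "(u, v) \<in> parcs G \<longleftrightarrow> (v, u) \<in> parcs G" "(v, v) \<notin> parcs G"
proof -
  interpret pair_graph G by fact
  show "finite (pverts G)" "finite (parcs G)" by auto
  show "parcs G \<subseteq> pverts G \<times> pverts G" by (auto dest: in_arcsD1 in_arcsD2)
  show "(u, v) \<in> parcs G \<longleftrightarrow> (v, u) \<in> parcs G"
    using arcs_symmetric by auto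
  show "(v, v) \<notin> parcs G" using pair_no_loops by fastforce
qed

lemma pair_graphI:
  assumes "finite (pverts G)" "parcs G \<subseteq> pverts G \<times> pverts G"
    "\<And>u v. (u, v) \<in> parcs G \<Longrightarrow> (v, u) \<in> parcs G" "\<And>v. (v, v) \<notin> parcs G"
  shows "pair_graph G"
proof -
  have "finite (parcs G)" using assms(1,2) by (meson finite_SigmaI finite_subset)
  then show ?thesis
    using assms by unfold_locales (auto simp: symmetric_def sym_def)
qed

text \<open>Carries the spectral theorem from matrix positions over to vertices, so that the later
  arguments deal only with functions on vertices.\<close>

lemma spectral_basis_exists:
  fixes G :: "'a::linorder pair_pre_digraph"
  assumes G: "pair_graph G"
  shows "\<exists>p d. spectral_basis G p d"
proof -
  note g = pair_graph_simple[OF G]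
  define n where "n = card (pverts G)"
  define vs where "vs = sorted_list_of_set (pverts G)"
  define A where "A = adj_mat G"
  have len: "length vs = n" by (simp add: vs_def n_def)
  have bij: "bij_betw (\<lambda>i. vs ! i) {..<n} (pverts G)"
    by (rule bij_betw_nth) (use g(1) len in \<open>auto simp: vs_def\<close>)
  have Aij: "A $$ (i, j) = (if (vs ! i, vs ! j) \<in> parcs G then 1 else 0)" if "i < n" "j < n" for i j
    using that by (simp add: A_def adj_mat_def Let_def vs_def n_def)
  have A: "A \<in> carrier_mat n n"
    by (simp add: A_def adj_mat_def Let_def n_def)
  have "transpose_mat A = A"
    by (rule eq_matI) (use A Aij g(4) in auto)
  then obtain P d where P: "P \<in> carrier_mat n n" "transpose_mat P * P = 1\<^sub>m n"
    and D: "transpose_mat P * A * P = mat n n (\<lambda>(i, j). if i = j then d i else 0)"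
    using real_symmetric_spectral[OF A] by blast
  have PP: "P * transpose_mat P = 1\<^sub>m n"
    using mat_mult_left_right_inverse[of "transpose_mat P" n P] P by simp
  \<comment> \<open>Column \<open>i\<close> of \<open>P\<close>, read as a function on vertices by
    inverting the enumeration \<open>vs\<close>.\<close>
  define p where "p i v = P $$ (the_inv_into {..<n} (\<lambda>i. vs ! i) v, i)" for i v
  have p: "p i (vs ! k) = P $$ (k, i)" if "k < n" for i k
    using bij that unfolding p_def by (subst the_inv_into_f_f) (auto simp: bij_betw_def)
  have sumV: "(\<Sum>v\<in>pverts G. h v) = (\<Sum>k<n. h (vs ! k))" for h :: "'a \<Rightarrow> real"
    using sum.reindex_bij_betw[OF bij] by metis
  have orth: "(\<Sum>v\<in>pverts G. p i v * p j v) = (if i = j then 1 else 0)"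
    if "i < n" "j < n" for i j
  proof -
    have "(\<Sum>v\<in>pverts G. p i v * p j v) = (transpose_mat P * P) $$ (i, j)"
      using P(1) that by (simp add: sumV p scalar_prod_def atLeast0LessThan)
    then show ?thesis using that by (simp add: P(2))
  qed
  \<comment> \<open>The rows of \<open>P\<close> are orthonormal too; this is what makes the
    expansion in the \<open>p i\<close> complete.\<close>
  have orth': "(\<Sum>i<n. P $$ (k, i) * P $$ (l, i)) = (if k = l then 1 else 0)"
    if "k < n" "l < n" for k l
  proof -
    have "(\<Sum>i<n. P $$ (k, i) * P $$ (l, i)) = (P * transpose_mat P) $$ (k, l)"
      using P(1) that by (simp add: scalar_prod_def atLeast0LessThan)
    then show ?thesis using that by (simp add: PP)
  qed
  have expand: "f v = (\<Sum>i<n. (\<Sum>u\<in>pverts G. p i u * f u) * p i v)" if "v \<in> pverts G" for f v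
  proof -
    have "v \<in> (\<lambda>i. vs ! i) ` {..<n}" using bij that by (simp add: bij_betw_def)
    then obtain k where k: "k < n" "v = vs ! k" by blast
    have "(\<Sum>i<n. (\<Sum>u\<in>pverts G. p i u * f u) * p i v)
        = (\<Sum>i<n. \<Sum>l<n. f (vs ! l) * (P $$ (k, i) * P $$ (l, i)))"
      using k by (simp add: sumV p sum_distrib_left sum_distrib_right mult_ac)
    also have "\<dots> = (\<Sum>l<n. f (vs ! l) * (\<Sum>i<n. P $$ (k, i) * P $$ (l, i)))"
      by (subst sum.swap) (simp add: sum_distrib_left)
    also have "\<dots> = (\<Sum>l<n. if l = k then f (vs ! l) else 0)"
      by (intro sum.cong refl) (use k orth' in auto)
    also have "\<dots> = f v" using k by simp
    finally show ?thesis by simp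
  qed
  have q: "qf G f = (\<Sum>i<n. d i * (\<Sum>v\<in>pverts G. p i v * f v)\<^sup>2)" for f
  proof -
    \<comment> \<open>\<open>F\<close> lists the values of \<open>f\<close> along \<open>vs\<close>,
      and \<open>C\<close> below holds its coordinates in the eigenbasis.\<close>
    define F where "F = vec n (\<lambda>i. f (vs ! i))"
    have F: "F \<in> carrier_vec n" by (simp add: F_def)
    define C where "C = transpose_mat P *\<^sub>v F"
    have C: "C \<in> carrier_vec n" using P F by (simp add: C_def)
    have PC: "P *\<^sub>v C = F"
      using P(1) F PP assoc_mult_mat_vec[of P n n "transpose_mat P" n F] by (simp add: C_def)
    have Ci: "C $ i = (\<Sum>v\<in>pverts G. p i v * f v)" if "i < n" for i
      using that P by (simp add: C_def F_def sumV p scalar_prod_def atLeast0LessThan)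
    have "qf G f = (\<Sum>(u, v) \<in> pverts G \<times> pverts G. if (u, v) \<in> parcs G then f u * f v else 0)"
      unfolding qf_def using g by (intro sum.mono_neutral_cong_left) auto
    also have "\<dots> = (\<Sum>i<n. \<Sum>j<n. if (vs ! i, vs ! j) \<in> parcs G then f (vs ! i) * f (vs ! j) else 0)"
      by (simp add: sum.cartesian_product[symmetric] sumV)
    also have "\<dots> = F \<bullet> (A *\<^sub>v F)"
      using A by (auto simp: scalar_prod_def F_def Aij sum_distrib_left atLeast0LessThan
          intro!: sum.cong)
    also have "\<dots> = (P *\<^sub>v C) \<bullet> (A *\<^sub>v (P *\<^sub>v C))"
      by (simp add: PC)
    also have "\<dots> = C \<bullet> (transpose_mat P *\<^sub>v (A *\<^sub>v (P *\<^sub>v C)))"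
      using transpose_vec_mult_scalar[of "transpose_mat P" n n "A *\<^sub>v (P *\<^sub>v C)" C] P A C by simp
    also have "transpose_mat P *\<^sub>v (A *\<^sub>v (P *\<^sub>v C)) = (transpose_mat P * A * P) *\<^sub>v C"
      using P(1) A C by (simp add: assoc_mult_mat_vec[of _ n n _ n])
    also have "C \<bullet> \<dots> = (\<Sum>i<n. C $ i * (\<Sum>j<n. (if i = j then d i else 0) * C $ j))"
      unfolding D using C by (simp add: scalar_prod_def atLeast0LessThan)
    also have "\<dots> = (\<Sum>i<n. d i * (\<Sum>v\<in>pverts G. p i v * f v)\<^sup>2)"
      by (intro sum.cong refl) (simp add: Ci if_distrib[of "\<lambda>x. x * _"] power2_eq_square cong: if_cong)
    finally show ?thesis .
  qed
  have "eig_count Q G = card {i. i < n \<and> Q (d i)}" for Q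
    unfolding eig_count_def A_def[symmetric]
    by (rule sum_order_char_poly_diagonalized[OF A P D])
  then have "spectral_basis G p d"
    unfolding spectral_basis_def n_def[symmetric] using orth expand q by blast
  then show ?thesis by blast
qed

section \<open>Eigenvalue counts as dimensions of definite subspaces\<close>

lemma homogeneous_system_nontrivial_solution:
  fixes a :: "'i \<Rightarrow> 'j \<Rightarrow> 'b::field"
  assumes "finite J" "finite I" "card J < card I"
  shows "\<exists>c. (\<exists>i\<in>I. c i \<noteq> 0) \<and> (\<forall>j\<in>J. (\<Sum>i\<in>I. c i * a i j) = 0)"
  using assms
proof (induction J arbitrary: I a rule: finite_induct)
  case empty
  then have "I \<noteq> {}" by auto
  then show ?case by (intro exI[of _ "\<lambda>_. 1"]) auto
next
  case (insert j J)
  show ?case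
  proof (cases "\<forall>i\<in>I. a i j = 0")
    case True
    have "card J < card I" using insert.hyps insert.prems by simp
    then obtain c where "\<exists>i\<in>I. c i \<noteq> 0" "\<forall>j\<in>J. (\<Sum>i\<in>I. c i * a i j) = 0"
      using insert.IH[OF insert.prems(1), of a] by blast
    then show ?thesis using True by (intro exI[of _ c]) simp
  next
    case False
    then obtain k where k: "k \<in> I" "a k j \<noteq> 0" by blast
    \<comment> \<open>Gaussian elimination with pivot \<open>a k j\<close>: every
      \<open>a' i j\<close> vanishes, which leaves the equations in \<open>J\<close> for the
      unknowns other than \<open>k\<close>.\<close>
    define a' where "a' i l = a i l - a i j / a k j * a k l" for i l
    have "card J < card (I - {k})" using insert.hyps insert.prems k by simp
    then obtain c where c: "\<exists>i\<in>I - {k}. c i \<noteq> 0" "\<forall>l\<in>J. (\<Sum>i\<in>I - {k}. c i * a' i l) = 0"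
      using insert.IH[of "I - {k}" a'] insert.prems by blast
    \<comment> \<open>Back substitution: the coefficient \<open>- s\<close> at \<open>k\<close> is
      the one that satisfies equation \<open>j\<close>.\<close>
    define s where "s = (\<Sum>i\<in>I - {k}. c i * a i j) / a k j"
    define c' where "c' = c(k := - s)"
    have "(\<Sum>i\<in>I. c' i * a i l) = (\<Sum>i\<in>I - {k}. c i * a i l) - s * a k l" for l
      using insert.prems k by (simp add: sum.remove[of I k] c'_def)
    moreover have "s * a k l = (\<Sum>i\<in>I - {k}. c i * (a i j / a k j * a k l))" for l
      unfolding s_def by (simp add: sum_divide_distrib sum_distrib_right mult.assoc)
    ultimately have *: "(\<Sum>i\<in>I. c' i * a i l) = (\<Sum>i\<in>I - {k}. c i * a' i l)" for l
      by (simp add: a'_def right_diff_distrib sum_subtractf)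
    have "\<forall>l\<in>insert j J. (\<Sum>i\<in>I. c' i * a i l) = 0"
      using c(2) k by (simp add: *) (simp add: a'_def)
    moreover have "\<exists>i\<in>I. c' i \<noteq> 0" using c(1) by (auto simp: c'_def)
    ultimately show ?thesis by blast
  qed
qed

text \<open>Such a family is automatically linearly independent; \<open>s = 1\<close> and \<open>s = -1\<close> give positive and
  negative definiteness.\<close>
definition definite_on ::
    "real \<Rightarrow> 'a pair_pre_digraph \<Rightarrow> 'i set \<Rightarrow> ('i \<Rightarrow> 'a \<Rightarrow> real) \<Rightarrow> bool" where
  "definite_on s G I b \<longleftrightarrow>
     (\<forall>c. (\<exists>i\<in>I. c i \<noteq> 0) \<longrightarrow> s * qf G (\<lambda>v. \<Sum>i\<in>I. c i * b i v) > 0)"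

text \<open>The dimension count behind the upper bounds: fewer linear conditions than vectors leave
  a nontrivial combination orthogonal to every \<open>p j\<close>.\<close>

lemma vanishing_combination:
  assumes "finite I" "finite J" "card J < card I"
  shows "\<exists>c. (\<exists>i\<in>I. c i \<noteq> 0) \<and>
    (\<forall>j\<in>J. (\<Sum>v\<in>V. p j v * (\<Sum>i\<in>I. c i * b i v)) = (0::real))"
proof -
  obtain c where c: "\<exists>i\<in>I. c i \<noteq> 0" "\<forall>j\<in>J. (\<Sum>i\<in>I. c i * (\<Sum>v\<in>V. p j v * b i v)) = 0"
    using homogeneous_system_nontrivial_solution[OF assms(2,1,3), of "\<lambda>i j. \<Sum>v\<in>V. p j v * b i v"]
    by blast
  have "(\<Sum>v\<in>V. p j v * (\<Sum>i\<in>I. c i * b i v)) = (\<Sum>i\<in>I. c i * (\<Sum>v\<in>V. p j v * b i v))" for j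
    by (simp add: sum_distrib_left mult_ac) (rule sum.swap)
  then show ?thesis using c by auto
qed

text \<open>A larger family would have a nontrivial combination orthogonal to all eigenvectors with
  \<open>s * d j > 0\<close>. Only terms of sign at most zero then remain in \<open>s * qf\<close>,
  against definiteness.\<close>

lemma card_definite_family_le:
  fixes G :: "'a::linorder pair_pre_digraph"
  assumes "pair_graph G" "finite I" "definite_on s G I b"
  shows "card I \<le> eig_count (\<lambda>x. s * x > 0) G"
proof (rule ccontr)
  assume less: "\<not> ?thesis"
  obtain p d where pd: "spectral_basis G p d" using spectral_basis_exists[OF assms(1)] by blast
  define n where "n = card (pverts G)"
  note sb = spectral_basisD[OF pd, folded n_def]
  define J where "J = {j. j < n \<and> s * d j > 0}"
  have "card J < card I"
    using less by (simp add: sb(4) J_def)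
  then obtain c where c: "\<exists>i\<in>I. c i \<noteq> 0"
    "\<forall>j\<in>J. (\<Sum>v\<in>pverts G. p j v * (\<Sum>i\<in>I. c i * b i v)) = 0"
    using vanishing_combination[OF assms(2), where J = J and V = "pverts G" and p = p and b = b] by (auto simp: J_def)
  define f where "f v = (\<Sum>i\<in>I. c i * b i v)" for v
  have "s * qf G f = (\<Sum>j<n. s * d j * (\<Sum>v\<in>pverts G. p j v * f v)\<^sup>2)"
    by (simp add: sb(3) sum_distrib_left mult.assoc)
  also have "\<dots> \<le> 0"
  proof (rule sum_nonpos)
    fix j assume "j \<in> {..<n}"
    then show "s * d j * (\<Sum>v\<in>pverts G. p j v * f v)\<^sup>2 \<le> 0"
      using c(2) by (cases "j \<in> J") (auto simp: J_def f_def mult_nonpos_nonneg)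
  qed
  finally show False
    using assms(3) c(1) unfolding definite_on_def f_def by force
qed

text \<open>The eigenvectors with \<open>s * d j > 0\<close> attain the preceding bound. The count
  is thus a maximum over definite families, a description without eigenvectors that can be moved
  between graphs.\<close>

lemma definite_family_exists:
  fixes G :: "'a::linorder pair_pre_digraph"
  assumes "pair_graph G"
  shows "\<exists>(I :: nat set) b. finite I \<and> card I = eig_count (\<lambda>x. s * x > 0) G \<and> definite_on s G I b"
proof -
  obtain p d where pd: "spectral_basis G p d" using spectral_basis_exists[OF assms(1)] by blast
  define n where "n = card (pverts G)"
  note sb = spectral_basisD[OF pd, folded n_def]
  define J where "J = {j. j < n \<and> s * d j > 0}"
  have J: "finite J" by (simp add: J_def)
  have "card J = eig_count (\<lambda>x. s * x > 0) G"
    by (simp add: sb(4) J_def)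
  moreover have "definite_on s G J p"
    unfolding definite_on_def
  proof (intro allI impI)
    fix c :: "nat \<Rightarrow> real" assume "\<exists>i\<in>J. c i \<noteq> 0"
    then obtain k where k: "k \<in> J" "c k \<noteq> 0" by blast
    have coord: "(\<Sum>v\<in>pverts G. p j v * (\<Sum>i\<in>J. c i * p i v)) = (if j \<in> J then c j else 0)"
      if "j < n" for j
    proof -
      have "(\<Sum>v\<in>pverts G. p j v * (\<Sum>i\<in>J. c i * p i v)) =
          (\<Sum>i\<in>J. c i * (\<Sum>v\<in>pverts G. p j v * p i v))"
        by (simp add: sum_distrib_left mult_ac) (rule sum.swap)
      also have "\<dots> = (\<Sum>i\<in>J. if j = i then c i else 0)"
        using that by (intro sum.cong refl) (simp add: sb(1) J_def)
      finally show ?thesis using J by simp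
    qed
    have "s * qf G (\<lambda>v. \<Sum>i\<in>J. c i * p i v) = (\<Sum>j<n. s * d j * (if j \<in> J then c j else 0)\<^sup>2)"
    proof -
      have "qf G (\<lambda>v. \<Sum>i\<in>J. c i * p i v) =
          (\<Sum>j<n. d j * (\<Sum>v\<in>pverts G. p j v * (\<Sum>i\<in>J. c i * p i v))\<^sup>2)"
        by (rule sb(3))
      also have "\<dots> = (\<Sum>j<n. d j * (if j \<in> J then c j else 0)\<^sup>2)"
        by (intro sum.cong refl) (simp only: lessThan_iff coord)
      finally show ?thesis by (simp add: sum_distrib_left mult.assoc)
    qed
    also have "\<dots> > 0"
      by (rule sum_pos2[of _ k]) (use k in \<open>auto simp: J_def less_imp_le\<close>)
    finally show "s * qf G (\<lambda>v. \<Sum>i\<in>J. c i * p i v) > 0" .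
  qed
  ultimately show ?thesis using J by blast
qed

text \<open>The semidefinite variant, where independence has to be assumed separately. A combination
  orthogonal to the eigenvectors with \<open>d j <= 0\<close> has a form that is both nonnegative
  and nonpositive, so all its coordinates vanish.\<close>

lemma card_nonpositive_family_le:
  fixes G :: "'a::linorder pair_pre_digraph"
  assumes "pair_graph G" "finite I"
    and nonpos: "\<And>c. qf G (\<lambda>v. \<Sum>i\<in>I. c i * b i v) \<le> 0"
    and indep: "\<And>c. \<forall>v\<in>pverts G. (\<Sum>i\<in>I. c i * b i v) = 0 \<Longrightarrow> \<forall>i\<in>I. c i = 0"
  shows "card I \<le> eig_count (\<lambda>x. x \<le> 0) G"
proof (rule ccontr)
  assume less: "\<not> ?thesis"
  obtain p d where pd: "spectral_basis G p d" using spectral_basis_exists[OF assms(1)] by blast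
  define n where "n = card (pverts G)"
  note sb = spectral_basisD[OF pd, folded n_def]
  define J where "J = {j. j < n \<and> d j \<le> 0}"
  have "card J < card I"
    using less by (simp add: sb(4) J_def)
  then obtain c where c: "\<exists>i\<in>I. c i \<noteq> 0"
    "\<forall>j\<in>J. (\<Sum>v\<in>pverts G. p j v * (\<Sum>i\<in>I. c i * b i v)) = 0"
    using vanishing_combination[OF assms(2), where J = J and V = "pverts G" and p = p and b = b] by (auto simp: J_def)
  define f where "f v = (\<Sum>i\<in>I. c i * b i v)" for v
  define x where "x j = (\<Sum>v\<in>pverts G. p j v * f v)" for j
  have xJ: "x j = 0" if "j \<in> J" for j using c(2) that by (simp add: x_def f_def)
  have terms: "0 \<le> d j * (x j)\<^sup>2" if "j < n" for j
    using that xJ by (cases "j \<in> J") (auto simp: J_def)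
  have "(\<Sum>j<n. d j * (x j)\<^sup>2) \<le> 0"
    using nonpos[of c] by (simp add: sb(3) x_def f_def)
  then have "(\<Sum>j<n. d j * (x j)\<^sup>2) = 0"
    using terms by (meson lessThan_iff order_antisym sum_nonneg)
  then have "\<forall>j<n. d j * (x j)\<^sup>2 = 0"
    using terms by (subst (asm) sum_nonneg_eq_0_iff) auto
  then have x0: "x j = 0" if "j < n" for j
    using that xJ by (cases "j \<in> J") (auto simp: J_def)
  have "f v = (\<Sum>j<n. x j * p j v)" if "v \<in> pverts G" for v
    using that unfolding x_def by (rule sb(2))
  then have "\<forall>v\<in>pverts G. f v = 0" by (simp add: x0)
  then show False using indep[of c] c(1) by (auto simp: f_def)
qed

lemma eig_count_trichotomy:
  fixes G :: "'a::linorder pair_pre_digraph"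
  assumes "pair_graph G"
  shows "n_pos G + (n_zero G + n_neg G) = card (pverts G)"
    and "eig_count (\<lambda>x. x \<le> 0) G = n_zero G + n_neg G"
proof -
  obtain p d where pd: "spectral_basis G p d" using spectral_basis_exists[OF assms(1)] by blast
  define n where "n = card (pverts G)"
  note sb = spectral_basisD[OF pd, folded n_def]
  note e = sb(4)
  have add: "eig_count Q G + eig_count R G = eig_count (\<lambda>x. Q x \<or> R x) G"
    if "\<And>x. \<not> (Q x \<and> R x)" for Q R
    unfolding e by (subst card_Un_disjoint[symmetric]) (use that in \<open>auto intro!: arg_cong[of _ _ card]\<close>)
  have "(\<lambda>x::real. x = 0 \<or> x < 0) = (\<lambda>x. x \<le> 0)" by auto
  then show 1: "eig_count (\<lambda>x. x \<le> 0) G = n_zero G + n_neg G"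
    unfolding n_zero_def n_neg_def by (subst add) auto
  have "n_pos G + eig_count (\<lambda>x. x \<le> 0) G = eig_count (\<lambda>x. True) G"
    unfolding n_pos_def by (subst add) (auto intro!: arg_cong[of _ _ "\<lambda>Q. eig_count Q G"])
  then show "n_pos G + (n_zero G + n_neg G) = card (pverts G)"
    by (simp add: 1 e n_def)
qed

section \<open>Deleting a vertex in the support of a null vector\<close>

definition del_vertex :: "'a pair_pre_digraph \<Rightarrow> 'a \<Rightarrow> 'a pair_pre_digraph" where
  "del_vertex G w = \<lparr>pverts = pverts G - {w}, parcs = {(u, v) \<in> parcs G. u \<noteq> w \<and> v \<noteq> w}\<rparr>"

lemma pair_graph_del_vertex:
  assumes "pair_graph G" shows "pair_graph (del_vertex G w)"
  using pair_graph_simple[OF assms] by (intro pair_graphI) (auto simp: del_vertex_def)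

lemma qf_del_vertex:
  assumes "pair_graph G"
  shows "qf (del_vertex G w) f = qf G (f(w := 0))"
  unfolding qf_def using pair_graph_simple[OF assms]
  by (intro sum.mono_neutral_cong_left) (auto simp: del_vertex_def)

text \<open>Since \<open>x w\<close> is nonzero, the functions vanishing at \<open>w\<close> form a
  complement of the null vector \<open>x\<close>, and the form restricted to them is that of the
  smaller graph. Definite families move up by setting values at \<open>w\<close> to zero and down by
  projecting along \<open>x\<close>.\<close>

lemma eig_count_del_vertex:
  fixes G :: "'a::linorder pair_pre_digraph"
  assumes G: "pair_graph G"
    and null: "\<And>f t. qf G (\<lambda>v. f v + t * x v) = qf G f" and w: "x w \<noteq> 0"
  shows "eig_count (\<lambda>y. s * y > 0) (del_vertex G w) = eig_count (\<lambda>y. s * y > 0) G"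
proof (rule antisym)
  note H = pair_graph_del_vertex[OF G, of w]
  obtain I :: "nat set" and b where I: "finite I" "card I = eig_count (\<lambda>x. s * x > 0) (del_vertex G w)"
    "definite_on s (del_vertex G w) I b"
    using definite_family_exists[OF H] by blast
  have "(\<lambda>v. \<Sum>i\<in>I. c i * ((b i)(w := 0)) v) = (\<lambda>v. \<Sum>i\<in>I. c i * b i v)(w := 0)" for c
    by auto
  then have "definite_on s G I (\<lambda>i. (b i)(w := 0))"
    using I(3) unfolding definite_on_def qf_del_vertex[OF G] by simp
  from card_definite_family_le[OF G I(1) this]
  show "eig_count (\<lambda>y. s * y > 0) (del_vertex G w) \<le> eig_count (\<lambda>y. s * y > 0) G"
    by (simp add: I(2))
next
  note H = pair_graph_del_vertex[OF G, of w]
  obtain I :: "nat set" and b where I: "finite I" "card I = eig_count (\<lambda>x. s * x > 0) G"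
    "definite_on s G I b"
    using definite_family_exists[OF G] by blast
  \<comment> \<open>Project along the null vector onto the functions vanishing at \<open>w\<close>.\<close>
  define b' where "b' i v = b i v - b i w / x w * x v" for i v
  have "qf (del_vertex G w) (\<lambda>v. \<Sum>i\<in>I. c i * b' i v) = qf G (\<lambda>v. \<Sum>i\<in>I. c i * b i v)" for c
  proof -
    \<comment> \<open>The multiple of \<open>x\<close> that makes the combination vanish at
      \<open>w\<close>.\<close>
    define t where "t = - (\<Sum>i\<in>I. c i * b i w) / x w"
    have "(\<lambda>v. \<Sum>i\<in>I. c i * b' i v)(w := 0) = (\<lambda>v. (\<Sum>i\<in>I. c i * b i v) + t * x v)"
      using w by (auto simp: b'_def t_def fun_eq_iff algebra_simps sum_subtractf
          sum_distrib_left sum_divide_distrib)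
    then show ?thesis unfolding qf_del_vertex[OF G] by (simp add: null)
  qed
  then have "definite_on s (del_vertex G w) I b'"
    using I(3) unfolding definite_on_def by simp
  from card_definite_family_le[OF H I(1) this]
  show "eig_count (\<lambda>y. s * y > 0) G \<le> eig_count (\<lambda>y. s * y > 0) (del_vertex G w)"
    by (simp add: I(2))
qed

text \<open>The signs \<open>s = 1\<close> and \<open>s = -1\<close> preserve two of the counts, so
  the zero count must absorb the lost vertex.\<close>

lemma inertia_del_vertex:
  fixes G :: "'a::linorder pair_pre_digraph"
  assumes G: "pair_graph G" and wV: "w \<in> pverts G"
    and null: "\<And>f t. qf G (\<lambda>v. f v + t * x v) = qf G f" and w: "x w \<noteq> 0"
  shows "n_pos (del_vertex G w) = n_pos G" "n_neg (del_vertex G w) = n_neg G"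
    "n_zero G = Suc (n_zero (del_vertex G w))"
proof -
  show pos: "n_pos (del_vertex G w) = n_pos G"
    using eig_count_del_vertex[OF G null w, of 1] by (simp add: n_pos_def)
  show neg: "n_neg (del_vertex G w) = n_neg G"
    using eig_count_del_vertex[OF G null w, of "-1"] by (simp add: n_neg_def)
  have "card (pverts G) = Suc (card (pverts (del_vertex G w)))"
    using card.remove[OF pair_graph_simple(1)[OF G] wV] by (simp add: del_vertex_def)
  then show "n_zero G = Suc (n_zero (del_vertex G w))"
    using eig_count_trichotomy(1)[OF G] eig_count_trichotomy(1)[OF pair_graph_del_vertex[OF G, of w]]
      pos neg by simp
qed

text \<open>An eigenvector for 0 serves as \<open>x\<close>: its coordinate enters the form with
  coefficient 0. Having norm 1, it is nonzero at some vertex \<open>w\<close>.\<close>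

lemma null_vector_exists:
  fixes G :: "'a::linorder pair_pre_digraph"
  assumes G: "pair_graph G" and "n_zero G > 0"
  obtains x w where "w \<in> pverts G" "x w \<noteq> 0" "\<And>f t. qf G (\<lambda>v. f v + t * x v) = qf G f"
proof -
  obtain p d where pd: "spectral_basis G p d" using spectral_basis_exists[OF G] by blast
  define n where "n = card (pverts G)"
  note sb = spectral_basisD[OF pd, folded n_def]
  have "card {i. i < n \<and> d i = 0} > 0"
    using assms(2) by (simp add: n_zero_def sb(4))
  then obtain k where k: "k < n" "d k = 0" by (auto simp: card_gt_0_iff)
  have "(\<Sum>v\<in>pverts G. p k v * p k v) \<noteq> 0"
    using k by (simp add: sb(1))
  then obtain w where "w \<in> pverts G" "p k w * p k w \<noteq> 0"
    by (rule sum.not_neutral_contains_not_neutral)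
  then have "w \<in> pverts G" "p k w \<noteq> 0" by auto
  moreover have "qf G (\<lambda>v. f v + t * p k v) = qf G f" for f t
  proof -
    have *: "(\<Sum>v\<in>pverts G. p j v * (f v + t * p k v)) =
        (\<Sum>v\<in>pverts G. p j v * f v) + t * (if j = k then 1 else 0)" if "j < n" for j
    proof -
      have "(\<Sum>v\<in>pverts G. p j v * (f v + t * p k v)) =
          (\<Sum>v\<in>pverts G. p j v * f v) + t * (\<Sum>v\<in>pverts G. p j v * p k v)"
        by (simp add: algebra_simps sum.distrib sum_distrib_left)
      then show ?thesis using k that by (simp add: sb(1))
    qed
    show ?thesis unfolding sb(3)
      by (intro sum.cong refl) (use k in \<open>auto simp: *\<close>)
  qed
  ultimately show thesis using that by blast
qed

lemma nonsingular_reduction: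
  fixes G :: "'a::linorder pair_pre_digraph"
  assumes "pair_graph G"
  shows "\<exists>H :: 'a pair_pre_digraph. pair_graph H \<and> n_pos H = n_pos G \<and> n_neg H = n_neg G \<and> n_zero H = 0"
  using assms
proof (induction "n_zero G" arbitrary: G)
  case 0
  then show ?case by (intro exI[of _ G]) simp
next
  case (Suc k)
  have "n_zero G > 0" using Suc.hyps(2) by simp
  obtain x w where null: "w \<in> pverts G" "x w \<noteq> 0" "\<And>f t. qf G (\<lambda>v. f v + t * x v) = qf G f"
    by (rule null_vector_exists[OF Suc.prems \<open>n_zero G > 0\<close>]) (rule that)
  note d = inertia_del_vertex[OF Suc.prems null(1,3,2)]
  have "k = n_zero (del_vertex G w)" using Suc.hyps(2) d(3) by simp
  from Suc.hyps(1)[OF this pair_graph_del_vertex[OF Suc.prems]] show ?case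
    unfolding d(1,2) .
qed

text \<open>Vertex deletion read backwards: the indicator of a fresh isolated vertex is a null
  vector of the enlarged graph, and deleting that vertex restores the old one.\<close>

lemma add_isolated_vertices:
  fixes G :: "'a::linorder pair_pre_digraph"
  assumes "pair_graph G" "infinite (UNIV :: 'a set)"
  shows "\<exists>H :: 'a pair_pre_digraph. pair_graph H \<and> n_pos H = n_pos G \<and> n_neg H = n_neg G \<and>
    n_zero H = n_zero G + k"
proof (induction k)
  case 0
  then show ?case using assms(1) by (intro exI[of _ G]) simp
next
  case (Suc k)
  then obtain H :: "'a pair_pre_digraph" where H: "pair_graph H" "n_pos H = n_pos G" "n_neg H = n_neg G"
    "n_zero H = n_zero G + k" by blast
  note h = pair_graph_simple[OF H(1)]
  obtain w where w: "w \<notin> pverts H" using h(1) assms(2) ex_new_if_finite by blast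
  define K where "K = \<lparr>pverts = insert w (pverts H), parcs = parcs H\<rparr>"
  have K: "pair_graph K" by (rule pair_graphI) (use h in \<open>auto simp: K_def\<close>)
  have del: "del_vertex K w = H"
    using w h(3) by (auto simp: del_vertex_def K_def intro!: pair_pre_digraph.equality)
  have "qf K (\<lambda>v. f v + t * (if v = w then 1 else 0)) = qf K f" for f t
    unfolding qf_def using w h(3) by (intro sum.cong refl) (auto simp: K_def)
  then have "n_pos H = n_pos K" "n_neg H = n_neg K" "n_zero K = Suc (n_zero H)"
    using inertia_del_vertex[OF K, of w "\<lambda>v. if v = w then 1 else 0"] unfolding del
    by (simp_all add: K_def)
  then show ?case using H K by (intro exI[of _ K]) simp
qed

section \<open>Finiteness and the extremal numbers\<close>

text \<open>The form vanishes on combinations of the indicators of \<open>S\<close>, since no arc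
  joins two points of \<open>S\<close>.\<close>

lemma indep_card_le:
  fixes G :: "'a::linorder pair_pre_digraph"
  assumes G: "pair_graph G" and S: "S \<subseteq> pverts G"
    and ind: "\<And>u v. u \<in> S \<Longrightarrow> v \<in> S \<Longrightarrow> (u, v) \<notin> parcs G"
  shows "card S \<le> n_zero G + n_neg G"
proof -
  have fin: "finite S" using pair_graph_simple(1)[OF G] S finite_subset by blast
  define b :: "'a \<Rightarrow> 'a \<Rightarrow> real" where "b i v = (if v = i then 1 else 0)" for i v
  have comb: "(\<Sum>i\<in>S. c i * b i v) = (if v \<in> S then c v else 0)" for c v
    using fin by (simp add: b_def if_distrib[of "\<lambda>x. _ * x"] cong: if_cong)
  have "card S \<le> eig_count (\<lambda>x. x \<le> 0) G"
  proof (rule card_nonpositive_family_le[OF G fin, of b])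
    fix c
    have "qf G (\<lambda>v. \<Sum>i\<in>S. c i * b i v) = 0"
      unfolding qf_def comb by (rule sum.neutral) (use ind in auto)
    then show "qf G (\<lambda>v. \<Sum>i\<in>S. c i * b i v) \<le> 0" by simp
  next
    fix c assume "\<forall>v\<in>pverts G. (\<Sum>i\<in>S. c i * b i v) = 0"
    then show "\<forall>i\<in>S. c i = 0" unfolding comb by (metis S subsetD)
  qed
  then show ?thesis using eig_count_trichotomy(2)[OF G] by simp
qed

text \<open>For \<open>f\<close> supported on the clique, \<open>qf G f\<close> is the square of the
  sum of \<open>f\<close> minus the sum of its squares. It is therefore negative definite on the
  functions of sum zero, a space of dimension \<open>card S - 1\<close>.\<close>

lemma clique_card_le:
  fixes G :: "'a::linorder pair_pre_digraph"
  assumes G: "pair_graph G" and S: "S \<subseteq> pverts G"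
    and cl: "\<And>u v. u \<in> S \<Longrightarrow> v \<in> S \<Longrightarrow> u \<noteq> v \<Longrightarrow> (u, v) \<in> parcs G"
  shows "card S \<le> Suc (n_neg G)"
proof (cases "S = {}")
  case False
  then obtain w where w: "w \<in> S" by blast
  note g = pair_graph_simple[OF G]
  have fin: "finite S" using g(1) S finite_subset by blast
  \<comment> \<open>For \<open>i\<close> other than \<open>w\<close>, the indicator of
    \<open>i\<close> minus that of \<open>w\<close>: a basis of the functions on \<open>S\<close> of
    sum zero.\<close>
  define b :: "'a \<Rightarrow> 'a \<Rightarrow> real" where "b i v = (if v = i then 1 else if v = w then -1 else 0)" for i v
  have "definite_on (-1) G (S - {w}) b"
    unfolding definite_on_def
  proof (intro allI impI)
    fix c :: "'a \<Rightarrow> real" assume nz: "\<exists>i\<in>S - {w}. c i \<noteq> 0"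
    define f where "f v = (\<Sum>i\<in>S - {w}. c i * b i v)" for v
    have f1: "f v = c v" if "v \<in> S - {w}" for v
      using fin that by (simp add: f_def b_def if_distrib[of "\<lambda>x. _ * x"] cong: if_cong)
    have f2: "f v = 0" if "v \<notin> S" for v
      unfolding f_def by (rule sum.neutral) (use that w in \<open>auto simp: b_def\<close>)
    then have fS: "v \<in> S" if "f v \<noteq> 0" for v
      using that by blast
    have fw: "f w = - (\<Sum>i\<in>S - {w}. c i)"
      unfolding f_def by (subst sum_negf[symmetric]) (rule sum.cong, auto simp: b_def)
    have sum0: "(\<Sum>v\<in>S. f v) = 0"
      using fin w f1 by (simp add: sum.remove[of S w] fw)
    have "qf G f = (\<Sum>(u, v)\<in>S \<times> S. f u * f v - (if u = v then f u * f v else 0))"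
      unfolding qf_def using fin g(2,5) cl fS
      by (intro sum.mono_neutral_cong) auto
    also have "\<dots> = (\<Sum>u\<in>S. f u) * (\<Sum>v\<in>S. f v) - (\<Sum>u\<in>S. (f u)\<^sup>2)"
      using fin by (simp add: sum.cartesian_product[symmetric] sum_subtractf sum_product power2_eq_square)
    finally have "- 1 * qf G f = (\<Sum>u\<in>S. (f u)\<^sup>2)" by (simp add: sum0)
    moreover obtain k where "k \<in> S - {w}" "c k \<noteq> 0" using nz by blast
    then have "(\<Sum>u\<in>S. (f u)\<^sup>2) > 0"
      using fin f1 by (intro sum_pos2[of _ k]) auto
    ultimately show "- 1 * qf G (\<lambda>v. \<Sum>i\<in>S - {w}. c i * b i v) > 0"
      by (simp add: f_def[abs_def])
  qed
  from card_definite_family_le[OF G _ this] fin w show ?thesis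
    by (simp add: n_neg_def)
qed simp

lemma n_pos_bounded:
  "\<exists>N. \<forall>G :: nat pair_pre_digraph. pair_graph G \<and> n_neg G \<le> k \<longrightarrow> n_pos G \<le> N"
proof -
  \<comment> \<open>The sizes \<open>k + 2\<close> and \<open>k + 1\<close> exceed by one the clique
    and independence bounds for a nonsingular graph with at most \<open>k\<close> negative
    eigenvalues.\<close>
  obtain N where N: "\<forall>(V :: nat set) E. finite V \<and> card V \<ge> N \<longrightarrow>
      (\<exists>R\<subseteq>V. card R = k + 2 \<and> clique R E \<or> card R = k + 1 \<and> indep R E)"
    using ramsey2[of "k + 2" "k + 1"] by (elim exE conjE) (rule that)
  have "n_pos G \<le> N" if G: "pair_graph G" "n_neg G \<le> k" for G :: "nat pair_pre_digraph"
  proof (rule ccontr)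
    assume "\<not> n_pos G \<le> N"
    \<comment> \<open>Passing to a nonsingular graph matters because the independence bound also
      contains the zero count.\<close>
    obtain H :: "nat pair_pre_digraph" where H: "pair_graph H" "n_pos H = n_pos G"
      "n_neg H = n_neg G" "n_zero H = 0"
      using nonsingular_reduction[OF G(1)] by blast
    note h = pair_graph_simple[OF H(1)]
    define E where "E = {{u, v} | u v. (u, v) \<in> parcs H}"
    have edge: "{u, v} \<in> E \<longleftrightarrow> (u, v) \<in> parcs H" for u v
      using h(4) by (auto simp: E_def doubleton_eq_iff)
    have large: "card (pverts H) \<ge> N"
      using eig_count_trichotomy(1)[OF H(1)] H \<open>\<not> n_pos G \<le> N\<close> by simp
    obtain R where R: "R \<subseteq> pverts H" "card R = k + 2 \<and> clique R E \<or> card R = k + 1 \<and> indep R E"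
      using N[rule_format, OF conjI, OF h(1) large, of E] by (elim exE conjE) (rule that)
    from R(2) show False
    proof
      assume *: "card R = k + 2 \<and> clique R E"
      then have "card R \<le> Suc (n_neg H)"
        using edge by (intro clique_card_le[OF H(1) R(1)]) (auto simp: clique_def)
      then show False using * H G by simp
    next
      assume *: "card R = k + 1 \<and> indep R E"
      have "(u, v) \<notin> parcs H" if "u \<in> R" "v \<in> R" for u v
        using * edge[of u v] h(5)[of u] that unfolding indep_def by (cases "u = v") auto
      then have "card R \<le> n_zero H + n_neg H"
        by (rule indep_card_le[OF H(1) R(1)])
      then show False using * H G by simp
    qed
  qed
  then show ?thesis by blast
qed

section \<open>The identity between the two extremal numbers\<close>

lemma M_max_eq: "M_max k = P_max k + k"
proof -
  define \<P> :: "nat pair_pre_digraph set" where "\<P> = {G. pair_graph G \<and> n_neg G \<le> k}"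
  define \<M> :: "nat pair_pre_digraph set" where "\<M> = {G. pair_graph G \<and> n_zero G + n_neg G \<le> k}"
  have P: "P_max k = Max (n_pos ` \<P>)"
    unfolding P_max_def \<P>_def setcompr_eq_image ..
  have M: "M_max k = Max ((\<lambda>G. card (pverts G)) ` \<M>)"
    unfolding M_max_def \<M>_def setcompr_eq_image ..
  obtain N where N: "\<forall>G :: nat pair_pre_digraph. pair_graph G \<and> n_neg G \<le> k \<longrightarrow> n_pos G \<le> N"
    by (rule exE[OF n_pos_bounded])
  have "n_pos ` \<P> \<subseteq> {..N}"
    using N by (intro image_subsetI) (simp add: \<P>_def)
  then have finP: "finite (n_pos ` \<P>)"
    by (rule finite_subset) simp
  \<comment> \<open>The empty graph shows that the maximum defining \<open>P_max k\<close> is over a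
    nonempty set, hence attained.\<close>
  define Z :: "nat pair_pre_digraph" where "Z = \<lparr>pverts = {}, parcs = {}\<rparr>"
  have Z: "pair_graph Z" by (rule pair_graphI) (simp_all add: Z_def)
  have "n_neg Z = 0" using eig_count_trichotomy(1)[OF Z] by (simp add: Z_def)
  then have "Z \<in> \<P>" using Z by (simp add: \<P>_def)
  then have "P_max k \<in> n_pos ` \<P>" unfolding P by (intro Max_in finP) blast
  then obtain G where "G \<in> \<P>" and GP: "n_pos G = P_max k"
    by (elim imageE) (rule that, simp_all)
  then have G: "pair_graph G" "n_neg G \<le> k" by (simp_all add: \<P>_def)
  have upper: "card (pverts H) \<le> P_max k + k" if "H \<in> \<M>" for H
  proof -
    have H: "pair_graph H" "n_zero H + n_neg H \<le> k" using that by (simp_all add: \<M>_def)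
    then have "n_pos H \<in> n_pos ` \<P>" by (intro imageI) (simp add: \<P>_def)
    then have "n_pos H \<le> P_max k" unfolding P by (rule Max_ge[OF finP])
    then show ?thesis using eig_count_trichotomy(1)[OF H(1)] H(2) by linarith
  qed
  obtain H1 :: "nat pair_pre_digraph" where H1: "pair_graph H1" "n_pos H1 = n_pos G"
    "n_neg H1 = n_neg G" "n_zero H1 = 0"
    using nonsingular_reduction[OF G(1)] by blast
  \<comment> \<open>The subtraction is not truncated, as \<open>n_neg G\<close> is at most
    \<open>k\<close>; the isolated vertices use up exactly the remaining allowance.\<close>
  obtain H :: "nat pair_pre_digraph" where H: "pair_graph H" "n_pos H = n_pos H1"
    "n_neg H = n_neg H1" "n_zero H = n_zero H1 + (k - n_neg G)"
    using add_isolated_vertices[OF H1(1) infinite_UNIV_nat, of "k - n_neg G"] by blast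
  have k: "n_zero H + n_neg H = k" using H H1 G by simp
  then have "H \<in> \<M>" using H(1) by (simp add: \<M>_def)
  moreover have card: "card (pverts H) = P_max k + k"
    using eig_count_trichotomy(1)[OF H(1)] k H H1 GP by simp
  ultimately have mem: "P_max k + k \<in> (\<lambda>G. card (pverts G)) ` \<M>"
    by (intro image_eqI[of _ _ H]) simp_all
  have sub: "(\<lambda>G. card (pverts G)) ` \<M> \<subseteq> {..P_max k + k}"
    using upper by (intro image_subsetI) simp
  show ?thesis
    unfolding M using sub finite_subset[OF sub] by (intro Max_eqI mem) blast+
qed

theorem mainTheorem5:
  shows "(\<forall>k::nat. k \<ge> 1 \<longrightarrow> M_max k = P_max k + k) \<and>
    ((\<lambda>k::nat. real (P_max k)) \<in> O(\<lambda>k. real k ^ 2) \<longleftrightarrow>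
     (\<lambda>k::nat. real (M_max k)) \<in> O(\<lambda>k. real k ^ 2))"
proof -
  have lin: "(\<lambda>k::nat. real k) \<in> O(\<lambda>k. real k ^ 2)"
    by (rule bigoI[of _ 1], rule eventually_sequentiallyI[of 1]) (simp add: power2_eq_square)
  \<comment> \<open>The identity also covers \<open>k = 0\<close>, so it is an equality of
    functions.\<close>
  have M: "(\<lambda>k. real (M_max k)) = (\<lambda>k. real (P_max k) + real k)"
    by (simp add: M_max_eq)
  \<comment> \<open>Each direction adds or subtracts the term \<open>k\<close>, which is itself in
    the quadratic class.\<close>
  have "(\<lambda>k. real (P_max k)) \<in> O(\<lambda>k. real k ^ 2) \<longleftrightarrow> (\<lambda>k. real (M_max k)) \<in> O(\<lambda>k. real k ^ 2)"
    unfolding M using sum_in_bigo(1)[OF _ lin, of "\<lambda>k. real (P_max k)"]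
      sum_in_bigo(2)[OF _ lin, of "\<lambda>k. real (P_max k) + real k"] by auto
  then show ?thesis by (simp add: M_max_eq)
qed

end
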